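(* Let $X$ and $Y$ be connected graphs without loops and multiple edges, and let $\phi:VX\to VY$ be a quasi-isometry. Then there exists a unique map $\Phi:VX\cup\Omega_{\mathrm{P}}X\to VY\cup\Omega_{\mathrm{P}}Y$ such that (1) $\Phi|_{VX}=\phi$; (2) $\Phi$ is continuous with respect to $\tau_{\mathrm{P}}X$ and $\tau_{\mathrm{P}}Y$; (3) $\Phi|_{\Omega_{\mathrm{P}}X}$ is a homeomorphism of $\Omega_{\mathrm{P}}X$ onto $\Omega_{\mathrm{P}}Y$ with respect to the relative topologies.
   Context: $\mathrm{d}_X$ denotes the graph metric of $X$. $\phi:VX\to VY$ is a quasi-isometry if there are $\psi:VY\to VX$ and constants $a,b,c,d$ such that for all $x,x_1,x_2\in VX$, $y,y_1,y_2\in VY$: $\mathrm{d}_Y(\phi(x_1),\phi(x_2))\le a\,\mathrm{d}_X(x_1,x_2)$, $\mathrm{d}_X(\psi(y_1),\psi(y_2))\le b\,\mathrm{d}_Y(y_1,y_2)$, $\mathrm{d}_X(\psi\phi(x),x)\le c$, $\mathrm{d}_Y(\phi\psi(y),y)\le d$. For $e\subseteq VX$, $e^{*}=VX\setminus e$, $\theta e$ is the set of vertices of $e^{*}$ adjacent to a vertex of $e$. A ray is a sequence of pairwise distinct vertices with consecutive ones adjacent; it lies in $e$ if all but finitely many of its vertices are in $e$; $e$ separates two rays if one lies in $e$ and the other in $e^{*}$. A metric cut is a set $e$ with $\operatorname{diam}\theta e<\infty$; a metric ray is a ray all of whose infinite subsequences have infinite diameter; two metric rays are metrically equivalent if no metric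 cut separates them; the classes are the proper metric ends. A proper metric end lies in $e$ if all its rays lie in $e$; $\Omega_{\mathrm{P}}e$ is the set of such ends, $\Omega_{\mathrm{P}}X=\Omega_{\mathrm{P}}VX$. $\tau_{\mathrm{P}}X$ is the topology on $VX\cup\Omega_{\mathrm{P}}X$ generated by $\{e\cup\Omega_{\mathrm{P}}e\mid e\subseteq VX,\ \operatorname{diam}\theta e<\infty\}$; similarly for $Y$. *)

theory Defs
  imports "HOL-Analysis.Abstract_Topology" "HOL-Library.Extended_Nat" "HOL-Library.FuncSet"
begin

record 'a ugraph =
  verts :: "'a set"
  adj :: "'a \<Rightarrow> 'a \<Rightarrow> bool"

text \<open>Adjacency is a binary relation, so multiple edges cannot occur.\<close>

definition simple_graph :: "'a ugraph \<Rightarrow> bool" where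
  "simple_graph G \<longleftrightarrow>
     (\<forall>u v. adj G u v \<longrightarrow> u \<in> verts G \<and> v \<in> verts G \<and> u \<noteq> v \<and> adj G v u)"

definition connected_graph :: "'a ugraph \<Rightarrow> bool" where
  "connected_graph G \<longleftrightarrow> (\<forall>u\<in>verts G. \<forall>v\<in>verts G. (adj G)\<^sup>*\<^sup>* u v)"

text \<open>\<open>(adj G ^^ n) u v\<close> says that there is a walk of length \<open>n\<close> from \<open>u\<close> to \<open>v\<close>. The value
  is meaningful only if there is a walk at all, as there always is in a connected graph.\<close>

definition gdist :: "'a ugraph \<Rightarrow> 'a \<Rightarrow> 'a \<Rightarrow> nat" where
  "gdist G u v = (LEAST n. (adj G ^^ n) u v)"

definition gdiam :: "'a ugraph \<Rightarrow> 'a set \<Rightarrow> enat" where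
  "gdiam G S = (SUP u\<in>S. SUP v\<in>S. enat (gdist G u v))"

definition quasi_isometry :: "'a ugraph \<Rightarrow> 'b ugraph \<Rightarrow> ('a \<Rightarrow> 'b) \<Rightarrow> bool" where
  "quasi_isometry X Y \<phi> \<longleftrightarrow> \<phi> \<in> verts X \<rightarrow> verts Y \<and>
     (\<exists>\<psi> \<in> verts Y \<rightarrow> verts X. \<exists>a b c d :: real.
        (\<forall>x\<^sub>1\<in>verts X. \<forall>x\<^sub>2\<in>verts X.
           real (gdist Y (\<phi> x\<^sub>1) (\<phi> x\<^sub>2)) \<le> a * real (gdist X x\<^sub>1 x\<^sub>2)) \<and>
        (\<forall>y\<^sub>1\<in>verts Y. \<forall>y\<^sub>2\<in>verts Y.
           real (gdist X (\<psi> y\<^sub>1) (\<psi> y\<^sub>2)) \<le> b * real (gdist Y y\<^sub>1 y\<^sub>2)) \<and>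
        (\<forall>x\<in>verts X. real (gdist X (\<psi> (\<phi> x)) x) \<le> c) \<and>
        (\<forall>y\<in>verts Y. real (gdist Y (\<phi> (\<psi> y)) y) \<le> d))"

definition vboundary :: "'a ugraph \<Rightarrow> 'a set \<Rightarrow> 'a set" where
  "vboundary G e = {v \<in> verts G - e. \<exists>u\<in>e. adj G u v}"

definition metric_cut :: "'a ugraph \<Rightarrow> 'a set \<Rightarrow> bool" where
  "metric_cut G e \<longleftrightarrow> e \<subseteq> verts G \<and> gdiam G (vboundary G e) < \<infinity>"

definition ray :: "'a ugraph \<Rightarrow> (nat \<Rightarrow> 'a) \<Rightarrow> bool" where
  "ray G r \<longleftrightarrow> range r \<subseteq> verts G \<and> inj r \<and> (\<forall>n. adj G (r n) (r (Suc n)))"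

definition lies_in :: "(nat \<Rightarrow> 'a) \<Rightarrow> 'a set \<Rightarrow> bool" where
  "lies_in r e \<longleftrightarrow> finite {n. r n \<notin> e}"

definition separates :: "'a ugraph \<Rightarrow> 'a set \<Rightarrow> (nat \<Rightarrow> 'a) \<Rightarrow> (nat \<Rightarrow> 'a) \<Rightarrow> bool" where
  "separates G e r s \<longleftrightarrow>
     lies_in r e \<and> lies_in s (verts G - e) \<or> lies_in s e \<and> lies_in r (verts G - e)"

definition metric_ray :: "'a ugraph \<Rightarrow> (nat \<Rightarrow> 'a) \<Rightarrow> bool" where
  "metric_ray G r \<longleftrightarrow>
     ray G r \<and> (\<forall>\<sigma> :: nat \<Rightarrow> nat. strict_mono \<sigma> \<longrightarrow> gdiam G (range (r \<circ> \<sigma>)) = \<infinity>)"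

definition metric_equiv :: "'a ugraph \<Rightarrow> ((nat \<Rightarrow> 'a) \<times> (nat \<Rightarrow> 'a)) set" where
  "metric_equiv G = {(r, s). metric_ray G r \<and> metric_ray G s \<and>
     \<not> (\<exists>e. metric_cut G e \<and> separates G e r s)}"

definition proper_metric_ends :: "'a ugraph \<Rightarrow> (nat \<Rightarrow> 'a) set set" where
  "proper_metric_ends G = {r. metric_ray G r} // metric_equiv G"

definition ends_in :: "'a ugraph \<Rightarrow> 'a set \<Rightarrow> (nat \<Rightarrow> 'a) set set" where
  "ends_in G e = {\<omega> \<in> proper_metric_ends G. \<forall>r\<in>\<omega>. lies_in r e}"

text \<open>The union of the vertex set and the set of ends is the disjoint sum
  \<open>verts G <+> ends_in G (verts G)\<close>.\<close>

definition end_topology :: "'a ugraph \<Rightarrow> ('a + (nat \<Rightarrow> 'a) set) topology" where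
  "end_topology G = topology_generated_by {e <+> ends_in G e | e. metric_cut G e}"

lemma topspace_end_topology:
  "topspace (end_topology G) = verts G <+> ends_in G (verts G)"
proof -
  have "metric_cut G (verts G)"
    by (simp add: metric_cut_def gdiam_def vboundary_def bot_enat_def)
  moreover have "e <+> ends_in G e \<subseteq> verts G <+> ends_in G (verts G)" if "metric_cut G e" for e
  proof -
    have "e \<subseteq> verts G" using that by (simp add: metric_cut_def)
    moreover from this have "lies_in r e \<Longrightarrow> lies_in r (verts G)" for r
      by (auto simp: lies_in_def elim!: rev_finite_subset)
    ultimately show ?thesis by (auto simp: ends_in_def)
  qed
  ultimately show ?thesis
    unfolding end_topology_def topology_generated_by_topspace by blast
qed

end

theory Submission
  imports Defs "HOL-Analysis.Abstract_Limits"
begin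

text \<open>A proper metric end is determined by the metric cuts in which it lies, since every metric ray
  crosses the bounded boundary of a metric cut only finitely often. The preimage of a metric cut
  under a quasi-isometry is a metric cut. The image of a metric ray is a sequence with bounded jumps
  that leaves every ball; joining consecutive points by geodesics and erasing loops turns it into a
  metric ray that lies in the same metric cuts. This defines the map on ends, and a quasi-inverse
  \<open>\<psi>\<close> gives the inverse map because \<open>\<psi> \<circ> \<phi>\<close> moves points by a bounded amount. Uniqueness holds
  because the vertices of a ray converge to its end and limits among the ends are unique.\<close>

section \<open>Eventual membership and finite diameter\<close>

lemma lies_in_iff_eventually: "lies_in r e \<longleftrightarrow> (\<forall>\<^sub>F n in sequentially. r n \<in> e)"
  by (simp add: lies_in_def flip: cofinite_eq_sequentially add: eventually_cofinite)

lemma lies_in_compose_strict_mono: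
  assumes "lies_in r e" "strict_mono (u :: nat \<Rightarrow> nat)"
  shows "lies_in (r \<circ> u) e"
  using assms filterlim_subseq[of u] unfolding lies_in_iff_eventually filterlim_iff by auto

lemma not_lies_in_both: "\<not> (lies_in r e \<and> lies_in r (V - e))"
proof
  assume "lies_in r e \<and> lies_in r (V - e)"
  then have "\<forall>\<^sub>F n in sequentially. r n \<in> e \<and> r n \<in> V - e"
    unfolding lies_in_iff_eventually by (auto intro: eventually_conj)
  then have "\<forall>\<^sub>F n :: nat in sequentially. False"
    by (rule eventually_mono) auto
  then show False by simp
qed

text \<open>A finite value in \<open>enat\<close> is a natural number bounding every pairwise
  distance, and a uniform bound bounds the supremum. All diameter estimates are made in this
  form.\<close>

lemma gdiam_finite_iff: "gdiam G S < \<infinity> \<longleftrightarrow> (\<exists>N. \<forall>u\<in>S. \<forall>v\<in>S. gdist G u v \<le> N)"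
proof
  assume "gdiam G S < \<infinity>"
  then obtain N where N: "gdiam G S = enat N" by (cases "gdiam G S") auto
  have "enat (gdist G u v) \<le> gdiam G S" if "u \<in> S" "v \<in> S" for u v
    unfolding gdiam_def using that by (meson SUP_upper2 order_refl)
  then show "\<exists>N. \<forall>u\<in>S. \<forall>v\<in>S. gdist G u v \<le> N" using N by auto
next
  assume "\<exists>N. \<forall>u\<in>S. \<forall>v\<in>S. gdist G u v \<le> N"
  then obtain N where "\<forall>u\<in>S. \<forall>v\<in>S. gdist G u v \<le> N" by blast
  then have "gdiam G S \<le> enat N" unfolding gdiam_def by (auto intro!: SUP_least)
  then show "gdiam G S < \<infinity>" by (rule order_le_less_trans) simp
qed

section \<open>Proper sequences and coarse rays\<close>

text \<open>The sequence leaves every ball. Indices are counted rather than values, so a proper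
  sequence takes each value only finitely often.\<close>

definition proper_seq :: "'a ugraph \<Rightarrow> (nat \<Rightarrow> 'a) \<Rightarrow> bool" where
  "proper_seq G p \<longleftrightarrow> range p \<subseteq> verts G \<and>
     (\<forall>v\<in>verts G. \<forall>N. finite {n. gdist G v (p n) \<le> N})"

text \<open>A substitute for metric rays that survives quasi-isometries: adjacency is relaxed to
  bounded jumps, and injectivity is dropped.\<close>

definition coarse_ray :: "'a ugraph \<Rightarrow> (nat \<Rightarrow> 'a) \<Rightarrow> bool" where
  "coarse_ray G p \<longleftrightarrow> proper_seq G p \<and> (\<exists>K. \<forall>n. gdist G (p n) (p (Suc n)) \<le> K)"

section \<open>The metric of a connected graph\<close>

locale conn_graph =
  fixes G :: "'a ugraph"
  assumes simple: "simple_graph G" and connected: "connected_graph G"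
begin

lemma adj_verts: "adj G u v \<Longrightarrow> u \<in> verts G" "adj G u v \<Longrightarrow> v \<in> verts G"
  and adj_sym: "adj G u v \<Longrightarrow> adj G v u"
  using simple by (auto simp: simple_graph_def)

lemma gdist_walk:
  assumes "u \<in> verts G" "v \<in> verts G" shows "(adj G ^^ gdist G u v) u v"
proof -
  have "(adj G)\<^sup>*\<^sup>* u v" using connected assms by (simp add: connected_graph_def)
  then obtain n where "(adj G ^^ n) u v" by (meson rtranclp_imp_relpowp)
  then show ?thesis unfolding gdist_def by (rule LeastI)
qed

lemma gdist_le: "(adj G ^^ n) u v \<Longrightarrow> gdist G u v \<le> n"
  unfolding gdist_def by (rule Least_le)

lemma gdist_self [simp]: "gdist G u u = 0"
  using gdist_le[of 0 u u] by simp

lemma gdist_adj: "adj G u v \<Longrightarrow> gdist G u v \<le> 1"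
  using gdist_le[of 1 u v] by (simp add: eq_OO)

lemma gdist_triangle:
  assumes "u \<in> verts G" "v \<in> verts G" "w \<in> verts G"
  shows "gdist G u w \<le> gdist G u v + gdist G v w"
  using gdist_walk[OF assms(1,2)] gdist_walk[OF assms(2,3)]
  by (intro gdist_le) (auto simp: relpowp_add)

lemma walk_sym: "(adj G ^^ n) u v \<Longrightarrow> (adj G ^^ n) v u"
proof (induction n arbitrary: v)
  case (Suc n)
  then obtain w where "(adj G ^^ n) u w" "adj G w v" by auto
  then show ?case using Suc.IH adj_sym by (blast intro: relpowp_Suc_I2)
qed simp

lemma gdist_sym:
  assumes "u \<in> verts G" "v \<in> verts G" shows "gdist G u v = gdist G v u"
  using assms by (meson antisym gdist_le gdist_walk walk_sym)

section \<open>Boundaries and metric cuts\<close>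

text \<open>The first vertex of the walk outside \<open>e\<close> belongs to the boundary, and the
  rest of the walk leads from it to \<open>v\<close>.\<close>

lemma walk_meets_vboundary:
  "(adj G ^^ n) u v \<Longrightarrow> u \<in> e \<Longrightarrow> v \<notin> e \<Longrightarrow> \<exists>z\<in>vboundary G e. gdist G z v \<le> n"
proof (induction n arbitrary: u)
  case (Suc n)
  then obtain w where w: "adj G u w" "(adj G ^^ n) w v" by (meson relpowp_Suc_D2)
  show ?case
  proof (cases "w \<in> e")
    case True
    with Suc w show ?thesis by (meson le_SucI)
  next
    case False
    with Suc.prems w have "w \<in> vboundary G e" by (auto simp: vboundary_def adj_verts)
    with gdist_le[OF w(2)] show ?thesis by (meson le_SucI)
  qed
qed auto

text \<open>The boundary vertex \<open>z\<close> on a geodesic from \<open>u\<close> to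
  \<open>v\<close> is within \<open>K\<close> of \<open>v\<close>, and returning from
  \<open>v\<close> to \<open>u\<close> costs another \<open>K\<close>. With one constant for both
  endpoints, either of them can play the part of the point under consideration.\<close>

lemma vboundary_near_both:
  assumes "u \<in> verts G" "v \<in> verts G" "u \<in> e" "v \<notin> e" "gdist G u v \<le> K"
  obtains z where "z \<in> vboundary G e" "gdist G z v \<le> 2 * K" "gdist G z u \<le> 2 * K"
proof -
  obtain z where z: "z \<in> vboundary G e" "gdist G z v \<le> gdist G u v"
    using walk_meets_vboundary[OF gdist_walk] assms by blast
  then have "z \<in> verts G" by (auto simp: vboundary_def)
  then have "gdist G z u \<le> gdist G z v + gdist G u v"
    using gdist_triangle[of z v u] gdist_sym[of u v] assms by auto
  then show ?thesis using that z assms by auto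
qed

text \<open>A boundary vertex of the complement has a neighbour in the boundary of \<open>e\<close>,
  so passing to the complement increases the diameter by at most 2.\<close>

lemma metric_cut_Compl:
  assumes "metric_cut G e" shows "metric_cut G (verts G - e)"
proof -
  obtain N where e: "e \<subseteq> verts G"
    and N: "\<And>u v. u \<in> vboundary G e \<Longrightarrow> v \<in> vboundary G e \<Longrightarrow> gdist G u v \<le> N"
    using assms unfolding metric_cut_def gdiam_finite_iff by blast
  have near: "\<exists>z\<in>vboundary G e. adj G u z" if "u \<in> vboundary G (verts G - e)" for u
    using that adj_sym adj_verts by (auto simp: vboundary_def)
  have "gdist G u v \<le> N + 2"
    if u: "u \<in> vboundary G (verts G - e)" and v: "v \<in> vboundary G (verts G - e)" for u v
  proof -
    obtain y z where yz: "y \<in> vboundary G e" "adj G u y" "z \<in> vboundary G e" "adj G v z"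
      using near u v by blast
    then have "u \<in> verts G" "v \<in> verts G" "y \<in> verts G" "z \<in> verts G"
      using adj_verts by blast+
    then show ?thesis
      using N[of y z] gdist_triangle[of u y v] gdist_triangle[of y z v]
        gdist_adj[of u y] gdist_adj[of z v] adj_sym[of v z] yz
      by linarith
  qed
  then show ?thesis unfolding metric_cut_def gdiam_finite_iff by blast
qed

section \<open>Metric rays and their position relative to metric cuts\<close>

lemma proper_seq_subseq:
  assumes "proper_seq G p" "strict_mono (u :: nat \<Rightarrow> nat)"
  shows "proper_seq G (p \<circ> u)"
proof -
  have "finite {n. gdist G v (p (u n)) \<le> N}" if "v \<in> verts G" for v N
  proof -
    have "finite (u -` {n. gdist G v (p n) \<le> N})"
      using assms that by (intro finite_vimageI) (auto simp: proper_seq_def strict_mono_imp_inj_on)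
    then show ?thesis by (simp add: vimage_def)
  qed
  then show ?thesis using assms by (auto simp: proper_seq_def)
qed

text \<open>If infinitely many indices fall into one ball, enumerating them gives a bounded
  subsequence. Conversely, a bounded subsequence stays in a ball about its first term, against
  properness.\<close>

lemma metric_ray_iff: "metric_ray G r \<longleftrightarrow> ray G r \<and> proper_seq G r"
proof (intro iffI conjI)
  assume r: "metric_ray G r"
  then show "ray G r" by (simp add: metric_ray_def)
  then have V: "\<And>n. r n \<in> verts G" by (auto simp: ray_def)
  have "finite {n. gdist G v (r n) \<le> N}" if v: "v \<in> verts G" for v N
  proof (rule ccontr)
    assume inf: "infinite {n. gdist G v (r n) \<le> N}"
    define \<sigma> where "\<sigma> = enumerate {n. gdist G v (r n) \<le> N}"
    have "strict_mono \<sigma>" "\<And>n. gdist G v (r (\<sigma> n)) \<le> N"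
      using inf enumerate_in_set[OF inf] by (auto simp: \<sigma>_def strict_mono_enumerate)
    moreover have "gdist G (r i) (r j) \<le> gdist G v (r i) + gdist G v (r j)" for i j
      using gdist_triangle[of "r i" v "r j"] gdist_sym[of v "r i"] v V by auto
    ultimately have "\<forall>a\<in>range (r \<circ> \<sigma>). \<forall>b\<in>range (r \<circ> \<sigma>). gdist G a b \<le> N + N"
      by (auto intro: order_trans[OF _ add_mono])
    then have "gdiam G (range (r \<circ> \<sigma>)) < \<infinity>" unfolding gdiam_finite_iff by blast
    with \<open>strict_mono \<sigma>\<close> r show False by (simp add: metric_ray_def)
  qed
  with V show "proper_seq G r" by (auto simp: proper_seq_def)
next
  assume "ray G r \<and> proper_seq G r"
  then have r: "ray G r" "proper_seq G r" by auto
  have "gdiam G (range (r \<circ> \<sigma>)) = \<infinity>" if "strict_mono \<sigma>" for \<sigma> :: "nat \<Rightarrow> nat"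
  proof (rule ccontr)
    assume "gdiam G (range (r \<circ> \<sigma>)) \<noteq> \<infinity>"
    then obtain N where N: "\<forall>a\<in>range (r \<circ> \<sigma>). \<forall>b\<in>range (r \<circ> \<sigma>). gdist G a b \<le> N"
      using gdiam_finite_iff[of G "range (r \<circ> \<sigma>)"] by auto
    have "r (\<sigma> 0) \<in> verts G" using r by (auto simp: ray_def)
    with proper_seq_subseq[OF r(2) that]
    have "finite {n. gdist G (r (\<sigma> 0)) (r (\<sigma> n)) \<le> N}"
      by (simp add: proper_seq_def)
    moreover have "{n. gdist G (r (\<sigma> 0)) (r (\<sigma> n)) \<le> N} = UNIV" using N by auto
    ultimately show False by simp
  qed
  with r show "metric_ray G r" by (simp add: metric_ray_def)
qed

text \<open>The boundary has bounded diameter, so its \<open>K\<close>-neighbourhood is contained in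
  a ball about any one boundary vertex \<open>y\<close>.\<close>

lemma proper_seq_finite_near_vboundary:
  assumes "proper_seq G p" "metric_cut G e"
  shows "finite {n. \<exists>z\<in>vboundary G e. gdist G z (p n) \<le> K}"
proof (cases "vboundary G e = {}")
  case False
  then obtain y where y: "y \<in> vboundary G e" by blast
  obtain N where N: "\<And>u v. u \<in> vboundary G e \<Longrightarrow> v \<in> vboundary G e \<Longrightarrow> gdist G u v \<le> N"
    using assms unfolding metric_cut_def gdiam_finite_iff by blast
  have V: "vboundary G e \<subseteq> verts G" by (auto simp: vboundary_def)
  have "gdist G y (p n) \<le> N + K" if "z \<in> vboundary G e" "gdist G z (p n) \<le> K" for z n
  proof -
    have "p n \<in> verts G" using assms(1) by (auto simp: proper_seq_def)
    then show ?thesis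
      using gdist_triangle[of y z "p n"] N[OF y that(1)] that V y by fastforce
  qed
  then have "{n. \<exists>z\<in>vboundary G e. gdist G z (p n) \<le> K} \<subseteq> {n. gdist G y (p n) \<le> N + K}" by auto
  moreover have "finite {n. gdist G y (p n) \<le> N + K}"
    using assms(1) y V by (auto simp: proper_seq_def)
  ultimately show ?thesis by (rule finite_subset)
qed simp

text \<open>Whenever \<open>p n\<close> is in \<open>e\<close> but \<open>q n\<close> is not,
  \<open>p n\<close> is near the boundary, and this happens for only finitely many
  \<open>n\<close>.\<close>

lemma lies_in_close:
  assumes p: "proper_seq G p" and q: "range q \<subseteq> verts G" and e: "metric_cut G e"
    and K: "\<And>n. gdist G (p n) (q n) \<le> K" and "lies_in p e"
  shows "lies_in q e"
proof -
  have "\<exists>z\<in>vboundary G e. gdist G z (p n) \<le> 2 * K" if "p n \<in> e" "q n \<notin> e" for n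
    by (rule vboundary_near_both[of "p n" "q n" e K])
      (use that K p q in \<open>auto simp: proper_seq_def\<close>)
  then have "{n. q n \<notin> e} \<subseteq> {n. p n \<notin> e} \<union> {n. \<exists>z\<in>vboundary G e. gdist G z (p n) \<le> 2 * K}"
    by blast
  with proper_seq_finite_near_vboundary[OF p e, of "2 * K"] \<open>lies_in p e\<close> show ?thesis
    unfolding lies_in_def by (meson finite_UnI finite_subset)
qed

text \<open>Bounded jumps can change sides of the cut only near its boundary, hence only finitely
  often. This dichotomy is what allows an end to be described by the metric cuts in which it
  lies.\<close>

lemma coarse_ray_lies_in_cases:
  assumes p: "coarse_ray G p" and e: "metric_cut G e"
  shows "lies_in p e \<or> lies_in p (verts G - e)"
proof -
  obtain K where K: "\<And>n. gdist G (p n) (p (Suc n)) \<le> K" and pp: "proper_seq G p"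
    using p by (auto simp: coarse_ray_def)
  have V: "p n \<in> verts G" for n using pp by (auto simp: proper_seq_def)
  \<comment> \<open>The condition covers jumps out of \<open>e\<close> and jumps into
    \<open>e\<close>. In the second case \<open>p (Suc n)\<close> is the inner endpoint, and the
    distance is turned around by symmetry.\<close>
  have "\<exists>z\<in>vboundary G e. gdist G z (p n) \<le> 2 * K" if "p n \<in> e \<longleftrightarrow> p (Suc n) \<notin> e" for n
  proof (cases "p n \<in> e")
    case True
    then show ?thesis
      using vboundary_near_both[of "p n" "p (Suc n)" e K] that K V by metis
  next
    case False
    then show ?thesis
      using vboundary_near_both[of "p (Suc n)" "p n" e K] that K V gdist_sym by metis
  qed
  then have "finite {n. p n \<in> e \<longleftrightarrow> p (Suc n) \<notin> e}"
    by (intro finite_subset[OF _ proper_seq_finite_near_vboundary[OF pp e, of "2 * K"]]) blast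
  then have "\<forall>\<^sub>F n in sequentially. p n \<in> e \<longleftrightarrow> p (Suc n) \<in> e"
    by (simp add: eventually_cofinite flip: cofinite_eq_sequentially)
  then obtain M where M: "\<And>n. n \<ge> M \<Longrightarrow> p n \<in> e \<longleftrightarrow> p (Suc n) \<in> e"
    by (auto simp: eventually_sequentially)
  have "p n \<in> e \<longleftrightarrow> p M \<in> e" if "n \<ge> M" for n
    using that by (induction n rule: dec_induct) (auto simp flip: M)
  then have const: "\<forall>\<^sub>F n in sequentially. p n \<in> e \<longleftrightarrow> p M \<in> e"
    by (rule eventually_sequentiallyI)
  show ?thesis
  proof (cases "p M \<in> e")
    case True
    then have "lies_in p e" using const by (simp add: lies_in_iff_eventually)
    then show ?thesis ..
  next
    case False
    then have "lies_in p (verts G - e)" using const V by (simp add: lies_in_iff_eventually)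
    then show ?thesis ..
  qed
qed

lemma metric_ray_coarse_ray: "metric_ray G r \<Longrightarrow> coarse_ray G r"
  using gdist_adj by (auto simp: metric_ray_iff coarse_ray_def ray_def intro!: exI[of _ 1])

section \<open>Replacing a coarse ray by a metric ray\<close>

text \<open>A geodesic from \<open>u\<close> to \<open>v\<close> that waits at \<open>v\<close> once
  it has arrived. The waiting gives all connecting paths the same length \<open>K\<close>, so they
  can be concatenated in blocks of equal size.\<close>

lemma lazy_path:
  assumes "u \<in> verts G" "v \<in> verts G" "gdist G u v \<le> K"
  obtains q where "q 0 = u" "q K = v" "\<And>j. q j = q (Suc j) \<or> adj G (q j) (q (Suc j))"
proof -
  define d where "d = gdist G u v"
  obtain f where f: "f 0 = u" "f d = v" "\<And>i. i < d \<Longrightarrow> adj G (f i) (f (Suc i))"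
    using gdist_walk[OF assms(1,2)] unfolding d_def[symmetric] relpowp_fun_conv by blast
  show ?thesis
  proof (rule that[of "\<lambda>j. f (min j d)"])
    show "f (min j d) = f (min (Suc j) d) \<or> adj G (f (min j d)) (f (min (Suc j) d))" for j
      using f(3)[of j] by (cases "j < d") auto
  qed (use f assms d_def in auto)
qed

lemma lazy_walk_dist:
  assumes "\<And>j. q j = q (Suc j) \<or> adj G (q j) (q (Suc j))" "q 0 \<in> verts G"
  shows "q j \<in> verts G \<and> gdist G (q 0) (q j) \<le> j"
proof (induction j)
  case (Suc j)
  have "q (Suc j) \<in> verts G" using Suc assms(1)[of j] adj_verts by auto
  moreover have "gdist G (q j) (q (Suc j)) \<le> 1" using assms(1)[of j] gdist_adj by auto
  ultimately show ?case
    using Suc gdist_triangle[of "q 0" "q j" "q (Suc j)"] assms(2) by auto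
qed (use assms in auto)

text \<open>Lazy paths of a common length \<open>L\<close> join consecutive terms of
  \<open>p\<close>, so \<open>p\<close> reappears as the subsequence of \<open>w\<close> at the
  multiples of \<open>L\<close>.\<close>

lemma coarse_ray_lazy_walk:
  assumes p: "coarse_ray G p"
  obtains w u where "proper_seq G w" "\<forall>n. w n = w (Suc n) \<or> adj G (w n) (w (Suc n))"
    "strict_mono u" "p = w \<circ> u"
proof -
  obtain K where K0: "\<And>n. gdist G (p n) (p (Suc n)) \<le> K" and pp: "proper_seq G p"
    using p by (auto simp: coarse_ray_def)
  \<comment> \<open>The successor keeps the block length positive even if \<open>K\<close> is 0, as
    division by \<open>L\<close> requires.\<close>
  define L where "L = Suc K"
  have V: "p n \<in> verts G" for n using pp by (auto simp: proper_seq_def)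
  have "\<exists>q. q 0 = p n \<and> q L = p (Suc n) \<and> (\<forall>j. q j = q (Suc j) \<or> adj G (q j) (q (Suc j)))" for n
    using lazy_path[OF V V, of n "Suc n" L] K0[of n] unfolding L_def by (metis le_SucI)
  then obtain q where q: "\<And>n. q n 0 = p n" "\<And>n. q n L = p (Suc n)"
    "\<And>n j. q n j = q n (Suc j) \<or> adj G (q n j) (q n (Suc j))" by metis
  define w where "w m = q (m div L) (m mod L)" for m
  have step: "w m = w (Suc m) \<or> adj G (w m) (w (Suc m))" for m
  \<comment> \<open>At the end of a block the next index opens a new one. The two paths fit together
    because both \<open>q n L\<close> and \<open>q (Suc n) 0\<close> equal
    \<open>p (Suc n)\<close>.\<close>
  proof (cases "Suc (m mod L) = L")
    case True
    then have "w (Suc m) = q (m div L) (Suc (m mod L))"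
      by (simp add: w_def q mod_Suc div_Suc)
    then show ?thesis using q(3) by (simp add: w_def)
  next
    case False
    then have "w (Suc m) = q (m div L) (Suc (m mod L))"
      by (simp add: w_def mod_Suc div_Suc)
    then show ?thesis using q(3) by (simp add: w_def)
  qed
  have q_near: "q n j \<in> verts G \<and> gdist G (p n) (q n j) \<le> j" for n j
    using lazy_walk_dist[of "q n" j] q V by simp
  have w_near: "w m \<in> verts G" "gdist G (p (m div L)) (w m) \<le> L" for m
    using q_near[of "m div L" "m mod L"] mod_less_divisor[of L m]
    by (auto simp: w_def L_def intro: order_trans)
  have "finite {m. gdist G v (w m) \<le> N}" if v: "v \<in> verts G" for v N
  proof -
    \<comment> \<open>Each term of \<open>w\<close> is within \<open>L\<close> of the start of its
      block, so a ball meets only the blocks whose starting points lie in a ball with radius larger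
      by \<open>L\<close>. There are finitely many such blocks, each with \<open>L\<close>
      indices.\<close>
    have "gdist G v (p (m div L)) \<le> N + L" if "gdist G v (w m) \<le> N" for m
      using gdist_triangle[of v "w m" "p (m div L)"] gdist_sym[of "w m" "p (m div L)"]
        w_near[of m] V v that by fastforce
    moreover have in_block: "m \<in> {m div L * L..<m div L * L + L}" for m
    proof -
      have "m mod L < L" by (simp add: L_def)
      then show ?thesis
        using div_mult_mod_eq[of m L] unfolding atLeastLessThan_iff by linarith
    qed
    ultimately have "{m. gdist G v (w m) \<le> N} \<subseteq>
        (\<Union>n\<in>{n. gdist G v (p n) \<le> N + L}. {n * L..<n * L + L})"
      using in_block by blast
    moreover have "finite \<dots>" using pp v by (auto simp: proper_seq_def)
    ultimately show ?thesis by (rule finite_subset)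
  qed
  then have "proper_seq G w" using w_near by (auto simp: proper_seq_def)
  then show ?thesis
  proof (rule that[of w "\<lambda>n. n * L"])
    show "\<forall>n. w n = w (Suc n) \<or> adj G (w n) (w (Suc n))" using step by blast
    show "strict_mono (\<lambda>n. n * L)" by (simp add: strict_mono_Suc_iff L_def)
    show "p = w \<circ> (\<lambda>n. n * L)" using q by (auto simp: w_def L_def simp del: mult_Suc_right)
  qed
qed

text \<open>Loop erasure: from each vertex, jump to the last visit of the vertex that follows its own
  last visit.\<close>

lemma loop_erasure:
  assumes w: "proper_seq G w" and step: "\<forall>n. w n = w (Suc n) \<or> adj G (w n) (w (Suc n))"
  obtains t where "strict_mono t" "metric_ray G (w \<circ> t)"
proof -
  \<comment> \<open>The index of the last visit to the vertex \<open>w i\<close>. The maximum exists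
    because the visits lie in the ball of radius 0 about \<open>w i\<close>, which a proper sequence
    meets finitely often.\<close>
  define l where "l i = Max {n. w n = w i}" for i
  have V: "w n \<in> verts G" for n using w by (auto simp: proper_seq_def)
  have fin: "finite {n. w n = w i}" for i
  proof (rule finite_subset)
    show "finite {n. gdist G (w i) (w n) \<le> 0}" using w V unfolding proper_seq_def by blast
  qed (auto simp: V)
  have wl: "w (l i) = w i" for i
    using Max_in[OF fin[of i]] unfolding l_def by blast
  have le_l: "n \<le> l i" if "w n = w i" for n i
    unfolding l_def using that fin by (auto intro: Max_ge)
  define t where "t = rec_nat (l 0) (\<lambda>_ k. l (Suc k))"
  have t: "t 0 = l 0" "t (Suc n) = l (Suc (t n))" for n by (simp_all add: t_def)
  have less: "t n < t (Suc n)" for n using le_l[of "Suc (t n)" "Suc (t n)"] t by auto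
  then have sm: "strict_mono t" by (simp add: strict_mono_Suc_iff)
  \<comment> \<open>Every chosen index is the last visit to its vertex. This gives injectivity, and
    it rules out waiting at \<open>t n\<close>, since \<open>Suc (t n)\<close> would be a later
    visit.\<close>
  have last: "m \<le> t n" if "w m = w (t n)" for m n
  proof (cases n)
    case 0
    then show ?thesis using that le_l[of m 0] by (simp add: t wl)
  next
    case (Suc k)
    then show ?thesis using that le_l[of m "Suc (t k)"] by (simp add: t wl)
  qed
  have "inj (w \<circ> t)"
  proof (rule injI)
    fix i j assume "(w \<circ> t) i = (w \<circ> t) j"
    then have "t i = t j" using last[of "t i" j] last[of "t j" i] by simp
    then show "i = j" using sm by (simp add: strict_mono_eq)
  qed
  moreover have "adj G (w (t n)) (w (t (Suc n)))" for n
    using spec[OF step, of "t n"] last[of "Suc (t n)" n] by (auto simp: t wl)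
  ultimately have "ray G (w \<circ> t)" using V by (auto simp: ray_def)
  with proper_seq_subseq[OF w sm] have "metric_ray G (w \<circ> t)" by (simp add: metric_ray_iff)
  with sm show ?thesis by (rule that)
qed

text \<open>Both \<open>p\<close> and the loop-erased ray are subsequences of the same lazy walk.
  That walk is itself a coarse ray, so it ends up on one side of each metric cut and takes both
  subsequences with it.\<close>

lemma coarse_ray_metric_ray:
  assumes p: "coarse_ray G p"
  obtains s where "metric_ray G s" "\<And>e. metric_cut G e \<Longrightarrow> lies_in s e \<longleftrightarrow> lies_in p e"
proof -
  obtain w u where w: "proper_seq G w" and step: "\<forall>n. w n = w (Suc n) \<or> adj G (w n) (w (Suc n))"
    and u: "strict_mono u" "p = w \<circ> u" using coarse_ray_lazy_walk[OF p] by blast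
  obtain t where t: "strict_mono t" "metric_ray G (w \<circ> t)" using loop_erasure[OF w] step by blast
  have "gdist G (w n) (w (Suc n)) \<le> 1" for n using spec[OF step, of n] gdist_adj by auto
  then have "coarse_ray G w" using w by (auto simp: coarse_ray_def)
  then have "lies_in (w \<circ> t) e \<longleftrightarrow> lies_in p e" if "metric_cut G e" for e
    using coarse_ray_lies_in_cases[OF _ that, of w] not_lies_in_both
      lies_in_compose_strict_mono[OF _ u(1)] lies_in_compose_strict_mono[OF _ t(1)] u(2) by metis
  with t(2) show ?thesis by (rule that)
qed

section \<open>Proper metric ends\<close>

text \<open>Since a metric ray lies in a metric cut or in its complement, and never in both, not
  being separated means lying in the same metric cuts. Transitivity is immediate in this
  form.\<close>

lemma metric_equiv_iff:
  "(r, s) \<in> metric_equiv G \<longleftrightarrow> metric_ray G r \<and> metric_ray G s \<and>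
     (\<forall>e. metric_cut G e \<longrightarrow> (lies_in r e \<longleftrightarrow> lies_in s e))"
proof -
  have "separates G e r s \<longleftrightarrow> (lies_in r e \<longleftrightarrow> \<not> lies_in s e)"
    if "metric_ray G r" "metric_ray G s" "metric_cut G e" for e
    unfolding separates_def
    using coarse_ray_lies_in_cases[OF metric_ray_coarse_ray that(3)] that not_lies_in_both
    by metis
  then show ?thesis unfolding metric_equiv_def by auto
qed

lemma equiv_metric_equiv: "equiv {r. metric_ray G r} (metric_equiv G)"
proof (rule equivI)
  show "metric_equiv G \<subseteq> {r. metric_ray G r} \<times> {r. metric_ray G r}"
    unfolding metric_equiv_def by blast
  show "refl_on {r. metric_ray G r} (metric_equiv G)"
    by (simp add: refl_on_def metric_equiv_iff)
  show "sym (metric_equiv G)" by (rule symI) (simp add: metric_equiv_iff)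
  show "trans (metric_equiv G)" by (rule transI) (simp add: metric_equiv_iff)
qed

lemma end_class: "metric_ray G r \<Longrightarrow> metric_equiv G `` {r} \<in> proper_metric_ends G"
  by (simp add: proper_metric_ends_def quotientI)

lemma end_nonempty:
  assumes "\<omega> \<in> proper_metric_ends G"
  obtains r where "r \<in> \<omega>" "metric_ray G r"
proof -
  obtain r where "metric_ray G r" "\<omega> = metric_equiv G `` {r}"
    using assms by (auto simp: proper_metric_ends_def elim: quotientE)
  then show ?thesis using that[of r] by (simp add: metric_equiv_iff)
qed

text \<open>Equivalent rays lie in the same metric cuts, so a single representative decides for the
  whole end.\<close>

lemma ends_in_iff:
  assumes "\<omega> \<in> proper_metric_ends G" "r \<in> \<omega>" "metric_cut G e"
  shows "\<omega> \<in> ends_in G e \<longleftrightarrow> lies_in r e"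
proof -
  \<comment> \<open>Taking both classes to be \<omega> in \<open>quotient_eq_iff\<close> relates any
    two of its members.\<close>
  have "(r, s) \<in> metric_equiv G" if "s \<in> \<omega>" for s
    using quotient_eq_iff[OF equiv_metric_equiv, of \<omega> \<omega> r s] assms that
    by (simp add: proper_metric_ends_def)
  then have "lies_in s e \<longleftrightarrow> lies_in r e" if "s \<in> \<omega>" for s
    using that assms(3) unfolding metric_equiv_iff by blast
  then show ?thesis using assms(1,2) unfolding ends_in_def by blast
qed

text \<open>Representatives of the two ends lie in the same metric cuts and are therefore
  equivalent. Later equalities of ends are reduced to metric cuts in this way.\<close>

lemma end_eqI:
  assumes "\<omega> \<in> proper_metric_ends G" "\<eta> \<in> proper_metric_ends G"
    and "\<And>e. metric_cut G e \<Longrightarrow> \<omega> \<in> ends_in G e \<longleftrightarrow> \<eta> \<in> ends_in G e"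
  shows "\<omega> = \<eta>"
proof -
  obtain r s where "r \<in> \<omega>" "metric_ray G r" "s \<in> \<eta>" "metric_ray G s"
    using assms end_nonempty by metis
  moreover from this have "lies_in r e \<longleftrightarrow> lies_in s e" if "metric_cut G e" for e
    using assms(3)[OF that] ends_in_iff[OF assms(1) _ that] ends_in_iff[OF assms(2) _ that] by blast
  ultimately have "(r, s) \<in> metric_equiv G" by (simp add: metric_equiv_iff)
  then show ?thesis
    using quotient_eq_iff[OF equiv_metric_equiv, of \<omega> \<eta> r s] assms(1,2) \<open>r \<in> \<omega>\<close> \<open>s \<in> \<eta>\<close>
    by (simp add: proper_metric_ends_def)
qed

lemma ends_in_verts: "ends_in G (verts G) = proper_metric_ends G"
proof -
  have "lies_in r (verts G)" if "\<omega> \<in> proper_metric_ends G" "r \<in> \<omega>" for \<omega> r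
    using that equiv_metric_equiv unfolding proper_metric_ends_def
    by (auto elim!: quotientE simp: metric_equiv_iff metric_ray_def ray_def lies_in_def range_subsetD)
  then show ?thesis by (auto simp: ends_in_def)
qed

lemma ends_in_cases:
  assumes "\<omega> \<in> proper_metric_ends G" "metric_cut G e"
  shows "\<omega> \<in> ends_in G e \<or> \<omega> \<in> ends_in G (verts G - e)"
proof -
  obtain r where r: "r \<in> \<omega>" "metric_ray G r" using end_nonempty[OF assms(1)] .
  then show ?thesis
    using coarse_ray_lies_in_cases[OF metric_ray_coarse_ray[OF r(2)] assms(2)]
      ends_in_iff[OF assms(1) r(1)] assms(2) metric_cut_Compl[OF assms(2)] by simp
qed

section \<open>Convergence of vertices to ends\<close>

lemma openin_cut: "metric_cut G e \<Longrightarrow> openin (end_topology G) (e <+> ends_in G e)"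
  unfolding end_topology_def by (rule topology_generated_by_Basis) blast

text \<open>For a generating set the claim says that \<open>r\<close> lies in the cut. It passes to
  finite intersections and arbitrary unions, so induction over the generated topology
  suffices.\<close>

lemma limitin_end:
  assumes \<omega>: "\<omega> \<in> proper_metric_ends G" and r: "r \<in> \<omega>"
  shows "limitin (end_topology G) (Inl \<circ> r) (Inr \<omega>) sequentially"
  unfolding limitin_def
proof (intro conjI allI impI)
  show "Inr \<omega> \<in> topspace (end_topology G)"
    using \<omega> by (simp add: topspace_end_topology ends_in_verts InrI)
next
  fix U assume U: "openin (end_topology G) U \<and> Inr \<omega> \<in> U"
  then have "generate_topology_on {e <+> ends_in G e |e. metric_cut G e} U"
    by (simp add: end_topology_def openin_topology_generated_by_iff)
  \<comment> \<open>Membership of the end is kept inside the induction claim because a union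
    contains it through only some of its members.\<close>
  then have "Inr \<omega> \<in> U \<longrightarrow> (\<forall>\<^sub>F n in sequentially. (Inl \<circ> r) n \<in> U)"
  proof induction
    case (Int A B)
    then show ?case by (auto intro: eventually_conj)
  next
    case (UN \<A>)
    show ?case
    proof
      assume "Inr \<omega> \<in> \<Union>\<A>"
      then obtain A where "A \<in> \<A>" "Inr \<omega> \<in> A" by blast
      then show "\<forall>\<^sub>F n in sequentially. (Inl \<circ> r) n \<in> \<Union>\<A>"
        using UN.IH[of A] by (auto elim: eventually_mono)
    qed
  next
    case (Basis S)
    then obtain e where "metric_cut G e" "S = e <+> ends_in G e" by blast
    then show ?case
      using ends_in_iff[OF \<omega> r] by (auto simp: lies_in_iff_eventually elim: eventually_mono)
  qed simp
  with U show "\<forall>\<^sub>F n in sequentially. (Inl \<circ> r) n \<in> U" by blast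
qed

lemma limitin_end_lies_in:
  assumes "limitin (end_topology G) (Inl \<circ> p) (Inr \<omega>) sequentially"
    and "metric_cut G e" "\<omega> \<in> ends_in G e"
  shows "lies_in p e"
proof -
  have "\<forall>\<^sub>F n in sequentially. (Inl \<circ> p) n \<in> e <+> ends_in G e"
    using assms openin_cut[OF assms(2)] unfolding limitin_def by blast
  then show ?thesis unfolding lies_in_iff_eventually by (rule eventually_mono) auto
qed

text \<open>The complement of a metric cut is again a metric cut, so a limiting end lies in
  \<open>e\<close> exactly if \<open>p\<close> does. The sequence thus determines the metric cuts of
  its limit.\<close>

lemma limitin_end_unique:
  assumes \<omega>: "limitin (end_topology G) (Inl \<circ> p) (Inr \<omega>) sequentially" "\<omega> \<in> proper_metric_ends G"
    and \<eta>: "limitin (end_topology G) (Inl \<circ> p) (Inr \<eta>) sequentially" "\<eta> \<in> proper_metric_ends G"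
  shows "\<omega> = \<eta>"
proof (rule end_eqI)
  fix e assume e: "metric_cut G e"
  have "\<zeta> \<in> ends_in G e \<longleftrightarrow> lies_in p e"
    if "limitin (end_topology G) (Inl \<circ> p) (Inr \<zeta>) sequentially" "\<zeta> \<in> proper_metric_ends G" for \<zeta>
    using limitin_end_lies_in[OF that(1) e] limitin_end_lies_in[OF that(1) metric_cut_Compl[OF e]]
      ends_in_cases[OF that(2) e] not_lies_in_both[of p e "verts G"] by blast
  then show "\<omega> \<in> ends_in G e \<longleftrightarrow> \<eta> \<in> ends_in G e" using \<omega> \<eta> by simp
qed (use assms in auto)

end

section \<open>The map induced on ends\<close>

text \<open>The image is specified by pulling back metric cuts, which avoids a choice of
  representative rays. For quasi-isometries such an end exists by \<open>end_map_ex\<close>, and by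
  \<open>end_eqI\<close> it is the only one.\<close>

definition end_map :: "'a ugraph \<Rightarrow> 'b ugraph \<Rightarrow> ('a \<Rightarrow> 'b) \<Rightarrow> (nat \<Rightarrow> 'a) set \<Rightarrow> (nat \<Rightarrow> 'b) set" where
  "end_map X Y \<phi> \<omega> = (SOME \<eta>. \<eta> \<in> proper_metric_ends Y \<and>
     (\<forall>f. metric_cut Y f \<longrightarrow> (\<eta> \<in> ends_in Y f \<longleftrightarrow> \<omega> \<in> ends_in X (\<phi> -` f \<inter> verts X))))"

text \<open>The restriction places the map in the extensional function space, where equality of maps
  means equality on the given domain.\<close>

definition end_extension ::
  "'a ugraph \<Rightarrow> 'b ugraph \<Rightarrow> ('a \<Rightarrow> 'b) \<Rightarrow> 'a + (nat \<Rightarrow> 'a) set \<Rightarrow> 'b + (nat \<Rightarrow> 'b) set" where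
  "end_extension X Y \<phi> =
     restrict (map_sum \<phi> (end_map X Y \<phi>)) (verts X <+> ends_in X (verts X))"

text \<open>One natural number serves as all four constants: the estimates stay in
  \<open>nat\<close>, and the assumptions become symmetric in \<phi> and \<psi>.\<close>

locale quasi_isometric_pair = X: conn_graph X + Y: conn_graph Y
  for X :: "'a ugraph" and Y :: "'b ugraph" +
  fixes \<phi> :: "'a \<Rightarrow> 'b" and \<psi> :: "'b \<Rightarrow> 'a" and K :: nat
  assumes phi_verts: "x \<in> verts X \<Longrightarrow> \<phi> x \<in> verts Y"
    and psi_verts: "y \<in> verts Y \<Longrightarrow> \<psi> y \<in> verts X"
    and phi_lipschitz: "x\<^sub>1 \<in> verts X \<Longrightarrow> x\<^sub>2 \<in> verts X \<Longrightarrow>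
      gdist Y (\<phi> x\<^sub>1) (\<phi> x\<^sub>2) \<le> K * gdist X x\<^sub>1 x\<^sub>2"
    and psi_lipschitz: "y\<^sub>1 \<in> verts Y \<Longrightarrow> y\<^sub>2 \<in> verts Y \<Longrightarrow>
      gdist X (\<psi> y\<^sub>1) (\<psi> y\<^sub>2) \<le> K * gdist Y y\<^sub>1 y\<^sub>2"
    and psi_phi_close: "x \<in> verts X \<Longrightarrow> gdist X (\<psi> (\<phi> x)) x \<le> K"
    and phi_psi_close: "y \<in> verts Y \<Longrightarrow> gdist Y (\<phi> (\<psi> y)) y \<le> K"
begin

text \<open>Through this symmetry every result about \<phi> is also available for \<psi>.\<close>

lemma swap: "quasi_isometric_pair Y X \<psi> \<phi> K"
  by unfold_locales
    (simp_all add: phi_verts psi_verts phi_lipschitz psi_lipschitz psi_phi_close phi_psi_close)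

text \<open>If \<phi> sends \<open>p n\<close> into a ball about \<open>v\<close>, then \<psi> sends
  that image into a ball about \<open>\<psi> v\<close>, and \<open>p n\<close> is within
  \<open>K\<close> of the result.\<close>

lemma proper_seq_image:
  assumes p: "proper_seq X p" shows "proper_seq Y (\<phi> \<circ> p)"
proof -
  have V: "p n \<in> verts X" for n using p by (auto simp: proper_seq_def)
  have "finite {n. gdist Y v (\<phi> (p n)) \<le> N}" if v: "v \<in> verts Y" for v N
  proof (rule finite_subset)
    show "finite {n. gdist X (\<psi> v) (p n) \<le> K * N + K}"
      using p psi_verts[OF v] by (simp add: proper_seq_def)
    show "{n. gdist Y v (\<phi> (p n)) \<le> N} \<subseteq> {n. gdist X (\<psi> v) (p n) \<le> K * N + K}"
    proof safe
      fix n assume "gdist Y v (\<phi> (p n)) \<le> N"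
      then have "K * gdist Y v (\<phi> (p n)) \<le> K * N" by simp
      moreover have "gdist X (\<psi> v) (p n) \<le> gdist X (\<psi> v) (\<psi> (\<phi> (p n))) + gdist X (\<psi> (\<phi> (p n))) (p n)"
        by (intro X.gdist_triangle psi_verts phi_verts V v)
      ultimately show "gdist X (\<psi> v) (p n) \<le> K * N + K"
        using psi_lipschitz[OF v phi_verts[OF V[of n]]] psi_phi_close[OF V[of n]] by linarith
    qed
  qed
  then show ?thesis using V phi_verts by (auto simp: proper_seq_def)
qed

lemma coarse_ray_image:
  assumes p: "coarse_ray X p" shows "coarse_ray Y (\<phi> \<circ> p)"
proof -
  obtain L where L: "\<And>n. gdist X (p n) (p (Suc n)) \<le> L" and pp: "proper_seq X p"
    using p by (auto simp: coarse_ray_def)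
  have V: "p n \<in> verts X" for n using pp by (auto simp: proper_seq_def)
  have "gdist Y (\<phi> (p n)) (\<phi> (p (Suc n))) \<le> K * L" for n
    using phi_lipschitz[OF V V, of n "Suc n"] mult_le_mono2[OF L[of n], of K] by linarith
  then show ?thesis using proper_seq_image[OF pp] by (auto simp: coarse_ray_def)
qed

text \<open>An edge leaving the preimage is mapped to two vertices at distance at most
  \<open>K\<close> on different sides of \<open>f\<close>. Hence \<phi> maps the boundary of the
  preimage near the boundary of \<open>f\<close>, and \<psi> carries the resulting bound back to
  \<open>X\<close>.\<close>

lemma metric_cut_vimage:
  assumes f: "metric_cut Y f" shows "metric_cut X (\<phi> -` f \<inter> verts X)"
proof -
  obtain N where N: "\<And>u v. u \<in> vboundary Y f \<Longrightarrow> v \<in> vboundary Y f \<Longrightarrow> gdist Y u v \<le> N"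
    using f unfolding metric_cut_def gdiam_finite_iff by blast
  let ?e = "\<phi> -` f \<inter> verts X"
  have near: "\<exists>z\<in>vboundary Y f. gdist Y z (\<phi> v) \<le> 2 * K" if v: "v \<in> vboundary X ?e" for v
  proof -
    obtain u where u: "u \<in> verts X" "\<phi> u \<in> f" "adj X u v" using v by (auto simp: vboundary_def)
    have v': "v \<in> verts X" "\<phi> v \<notin> f" using v by (auto simp: vboundary_def)
    have "gdist Y (\<phi> u) (\<phi> v) \<le> K"
      using phi_lipschitz[OF u(1) v'(1)] mult_le_mono2[OF X.gdist_adj[OF u(3)], of K] by linarith
    then show ?thesis
      using Y.vboundary_near_both[OF phi_verts[OF u(1)] phi_verts[OF v'(1)] u(2) v'(2)] by blast
  qed
  \<comment> \<open>The images of \<open>u\<close> and \<open>v\<close> are at most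
    \<open>2 * K + N + 2 * K\<close> apart. Applying \<psi> multiplies this by \<open>K\<close>, and
    returning to \<open>u\<close> and \<open>v\<close> costs \<open>K\<close> each.\<close>
  have "gdist X u v \<le> K * (N + 4 * K) + 2 * K"
    if u: "u \<in> vboundary X ?e" and v: "v \<in> vboundary X ?e" for u v
  proof -
    obtain y z where y: "y \<in> vboundary Y f" "gdist Y y (\<phi> u) \<le> 2 * K"
      and z: "z \<in> vboundary Y f" "gdist Y z (\<phi> v) \<le> 2 * K" using near u v by meson
    have V: "u \<in> verts X" "v \<in> verts X" "y \<in> verts Y" "z \<in> verts Y"
      using u v y z by (auto simp: vboundary_def)
    note W = phi_verts[OF V(1)] phi_verts[OF V(2)]
    have "gdist Y (\<phi> u) (\<phi> v) \<le> N + 4 * K"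
      using Y.gdist_triangle[OF W(1) V(3) W(2)] Y.gdist_triangle[OF V(3) V(4) W(2)]
        Y.gdist_sym[OF W(1) V(3)] N[OF y(1) z(1)] y z by linarith
    then have "K * gdist Y (\<phi> u) (\<phi> v) \<le> K * (N + 4 * K)" by (rule mult_le_mono2)
    then show ?thesis
      using X.gdist_triangle[OF V(1) psi_verts[OF W(1)] V(2)]
        X.gdist_triangle[OF psi_verts[OF W(1)] psi_verts[OF W(2)] V(2)]
        X.gdist_sym[OF V(1) psi_verts[OF W(1)]] psi_phi_close[OF V(1)] psi_phi_close[OF V(2)]
        psi_lipschitz[OF W] by linarith
  qed
  then show ?thesis unfolding metric_cut_def gdiam_finite_iff by blast
qed

lemma lies_in_vimage:
  "range p \<subseteq> verts X \<Longrightarrow> lies_in p (\<phi> -` f \<inter> verts X) \<longleftrightarrow> lies_in (\<phi> \<circ> p) f"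
  by (simp add: lies_in_def range_subsetD)

text \<open>The image of a representative is a coarse ray. The class of a metric ray lying in the
  same metric cuts as that image has the required property.\<close>

lemma end_map_ex:
  assumes \<omega>: "\<omega> \<in> proper_metric_ends X"
  shows "\<exists>\<eta>. \<eta> \<in> proper_metric_ends Y \<and>
     (\<forall>f. metric_cut Y f \<longrightarrow> (\<eta> \<in> ends_in Y f \<longleftrightarrow> \<omega> \<in> ends_in X (\<phi> -` f \<inter> verts X)))"
proof -
  obtain r where r: "r \<in> \<omega>" "metric_ray X r" using X.end_nonempty[OF \<omega>] .
  then have V: "range r \<subseteq> verts X" by (simp add: metric_ray_def ray_def)
  obtain s where s: "metric_ray Y s" "\<And>f. metric_cut Y f \<Longrightarrow> lies_in s f \<longleftrightarrow> lies_in (\<phi> \<circ> r) f"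
    using Y.coarse_ray_metric_ray[OF coarse_ray_image[OF X.metric_ray_coarse_ray[OF r(2)]]] by blast
  let ?\<eta> = "metric_equiv Y `` {s}"
  have \<eta>: "?\<eta> \<in> proper_metric_ends Y" "s \<in> ?\<eta>"
    using s(1) by (auto simp: Y.end_class Y.metric_equiv_iff)
  have "?\<eta> \<in> ends_in Y f \<longleftrightarrow> \<omega> \<in> ends_in X (\<phi> -` f \<inter> verts X)" if f: "metric_cut Y f" for f
    using Y.ends_in_iff[OF \<eta> f] X.ends_in_iff[OF \<omega> r(1) metric_cut_vimage[OF f]]
      s(2)[OF f] lies_in_vimage[OF V] by simp
  with \<eta>(1) show ?thesis by blast
qed

lemma end_map_in_ends:
  assumes "\<omega> \<in> proper_metric_ends X"
  shows "end_map X Y \<phi> \<omega> \<in> proper_metric_ends Y"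
  using someI_ex[OF end_map_ex[OF assms], folded end_map_def] by (rule conjunct1)

lemma end_map_in_iff:
  assumes "\<omega> \<in> proper_metric_ends X" "metric_cut Y f"
  shows "end_map X Y \<phi> \<omega> \<in> ends_in Y f \<longleftrightarrow> \<omega> \<in> ends_in X (\<phi> -` f \<inter> verts X)"
  using someI_ex[OF end_map_ex[OF assms(1)], folded end_map_def] assms(2) by simp

text \<open>Both ends are compared on metric cuts through one ray \<open>r\<close>: applying \<phi>
  and then \<psi> moves its vertices by at most \<open>K\<close>, so the new sequence lies in the
  same metric cuts as \<open>r\<close>.\<close>

lemma end_map_inverse:
  assumes \<omega>: "\<omega> \<in> proper_metric_ends X"
  shows "end_map Y X \<psi> (end_map X Y \<phi> \<omega>) = \<omega>"
proof (rule X.end_eqI)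
  interpret S: quasi_isometric_pair Y X \<psi> \<phi> K by (rule swap)
  show "end_map Y X \<psi> (end_map X Y \<phi> \<omega>) \<in> proper_metric_ends X"
    using \<omega> by (simp add: end_map_in_ends S.end_map_in_ends)
  fix e assume e: "metric_cut X e"
  obtain r where r: "r \<in> \<omega>" "metric_ray X r" using X.end_nonempty[OF \<omega>] .
  then have V: "range r \<subseteq> verts X" and p: "proper_seq X r"
    by (auto simp: X.metric_ray_iff ray_def)
  then have V': "range (\<psi> \<circ> (\<phi> \<circ> r)) \<subseteq> verts X" "range (\<phi> \<circ> r) \<subseteq> verts Y"
    using phi_verts psi_verts by auto
  have close: "gdist X ((\<psi> \<circ> (\<phi> \<circ> r)) n) (r n) \<le> K" for n
    using V psi_phi_close by auto
  have close': "gdist X (r n) ((\<psi> \<circ> (\<phi> \<circ> r)) n) \<le> K" for n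
    using close[of n] X.gdist_sym V V' by (metis range_subsetD)
  \<comment> \<open>The cut \<open>e\<close> is pulled back first along \<psi> and then along
    \<phi>.\<close>
  have "end_map Y X \<psi> (end_map X Y \<phi> \<omega>) \<in> ends_in X e
      \<longleftrightarrow> lies_in r (\<phi> -` (\<psi> -` e \<inter> verts Y) \<inter> verts X)"
    using S.end_map_in_iff[OF end_map_in_ends[OF \<omega>] e]
      end_map_in_iff[OF \<omega> S.metric_cut_vimage[OF e]]
      X.ends_in_iff[OF \<omega> r(1) metric_cut_vimage[OF S.metric_cut_vimage[OF e]]] by simp
  also have "\<dots> \<longleftrightarrow> lies_in (\<psi> \<circ> (\<phi> \<circ> r)) e"
    by (simp only: lies_in_vimage[OF V] S.lies_in_vimage[OF V'(2)])
  also have "\<dots> \<longleftrightarrow> lies_in r e"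
    using X.lies_in_close[OF p V'(1) e close']
      X.lies_in_close[OF S.proper_seq_image[OF proper_seq_image[OF p]] V e close] by blast
  also have "\<dots> \<longleftrightarrow> \<omega> \<in> ends_in X e" using X.ends_in_iff[OF \<omega> r(1) e] by simp
  finally show "end_map Y X \<psi> (end_map X Y \<phi> \<omega>) \<in> ends_in X e \<longleftrightarrow> \<omega> \<in> ends_in X e" .
qed (rule \<omega>)

section \<open>The extension and its continuity\<close>

lemma end_extension_PiE:
  "end_extension X Y \<phi> \<in>
     (verts X <+> ends_in X (verts X)) \<rightarrow>\<^sub>E (verts Y <+> ends_in Y (verts Y))"
  unfolding end_extension_def X.ends_in_verts Y.ends_in_verts
  using phi_verts end_map_in_ends by (intro restrict_PiE_iff[THEN iffD2]) auto

lemma end_extension_Inl: "x \<in> verts X \<Longrightarrow> end_extension X Y \<phi> (Inl x) = Inl (\<phi> x)"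
  by (simp add: end_extension_def InlI)

lemma end_extension_Inr:
  "\<omega> \<in> proper_metric_ends X \<Longrightarrow> end_extension X Y \<phi> (Inr \<omega>) = Inr (end_map X Y \<phi> \<omega>)"
  by (simp add: end_extension_def X.ends_in_verts InrI)

text \<open>The preimage of the generating set of a metric cut \<open>f\<close> is the generating
  set of the preimage of \<open>f\<close>, which is a metric cut as well.\<close>

lemma continuous_map_end_extension:
  "continuous_map (end_topology X) (end_topology Y) (end_extension X Y \<phi>)"
proof -
  have "continuous_map (end_topology X) (topology_generated_by {f <+> ends_in Y f |f. metric_cut Y f})
    (end_extension X Y \<phi>)"
  proof (rule continuous_on_generated_topo)
    fix U assume "U \<in> {f <+> ends_in Y f |f. metric_cut Y f}"
    then obtain f where f: "metric_cut Y f" "U = f <+> ends_in Y f" by blast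
    have "\<omega> \<in> proper_metric_ends X" if "\<omega> \<in> ends_in X e" for \<omega> e
      using that by (simp add: ends_in_def)
    then have "end_extension X Y \<phi> -` U \<inter> topspace (end_topology X) =
        (\<phi> -` f \<inter> verts X) <+> ends_in X (\<phi> -` f \<inter> verts X)"
      using end_map_in_iff[OF _ f(1)]
      by (auto simp: f(2) topspace_end_topology X.ends_in_verts end_extension_Inl end_extension_Inr)
    then show "openin (end_topology X) (end_extension X Y \<phi> -` U \<inter> topspace (end_topology X))"
      using X.openin_cut[OF metric_cut_vimage[OF f(1)]] by simp
  next
    have "end_extension X Y \<phi> ` topspace (end_topology X) \<subseteq> topspace (end_topology Y)"
      using end_extension_PiE unfolding topspace_end_topology by blast
    then show "end_extension X Y \<phi> ` topspace (end_topology X)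
        \<subseteq> \<Union> {f <+> ends_in Y f |f. metric_cut Y f}"
      unfolding end_topology_def topology_generated_by_topspace .
  qed
  then show ?thesis by (simp add: end_topology_def)
qed

lemma continuous_map_end_extension_ends:
  "continuous_map
     (subtopology (end_topology X) (Inr ` ends_in X (verts X)))
     (subtopology (end_topology Y) (Inr ` ends_in Y (verts Y))) (end_extension X Y \<phi>)"
  using end_extension_Inr end_map_in_ends
  by (intro continuous_map_into_subtopology continuous_map_from_subtopology
      continuous_map_end_extension) (auto simp: X.ends_in_verts Y.ends_in_verts)

text \<open>On ends the extension of \<psi> is a continuous two-sided inverse, although \<psi> need
  not invert \<phi> on vertices.\<close>

lemma homeomorphic_map_end_extension:
  "homeomorphic_map
     (subtopology (end_topology X) (Inr ` ends_in X (verts X)))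
     (subtopology (end_topology Y) (Inr ` ends_in Y (verts Y))) (end_extension X Y \<phi>)"
proof -
  interpret S: quasi_isometric_pair Y X \<psi> \<phi> K by (rule swap)
  have "homeomorphic_maps
     (subtopology (end_topology X) (Inr ` ends_in X (verts X)))
     (subtopology (end_topology Y) (Inr ` ends_in Y (verts Y)))
     (end_extension X Y \<phi>) (end_extension Y X \<psi>)"
    using continuous_map_end_extension_ends S.continuous_map_end_extension_ends
    by (auto simp: homeomorphic_maps_def X.ends_in_verts Y.ends_in_verts end_extension_Inr
        S.end_extension_Inr end_map_in_ends S.end_map_in_ends end_map_inverse S.end_map_inverse)
  then show ?thesis by (simp add: homeomorphic_maps_map)
qed

section \<open>Uniqueness of the extension\<close>

text \<open>At an end, both maps send a representative ray to the same sequence of vertices. By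
  continuity this sequence converges to both values, which are ends and hence equal.\<close>

lemma end_extension_unique:
  assumes PiE: "\<Phi> \<in> (verts X <+> ends_in X (verts X)) \<rightarrow>\<^sub>E (verts Y <+> ends_in Y (verts Y))"
    and ext: "\<forall>x\<in>verts X. \<Phi> (Inl x) = Inl (\<phi> x)"
    and cont: "continuous_map (end_topology X) (end_topology Y) \<Phi>"
    and ends: "\<Phi> ` Inr ` ends_in X (verts X) \<subseteq> Inr ` ends_in Y (verts Y)"
  shows "\<Phi> = end_extension X Y \<phi>"
proof (rule PiE_ext[OF PiE end_extension_PiE])
  fix z assume "z \<in> verts X <+> ends_in X (verts X)"
  then show "\<Phi> z = end_extension X Y \<phi> z"
  proof (rule PlusE)
    fix \<omega> assume "\<omega> \<in> ends_in X (verts X)" and z: "z = Inr \<omega>"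
    then have \<omega>: "\<omega> \<in> proper_metric_ends X" by (simp add: X.ends_in_verts)
    obtain r where r: "r \<in> \<omega>" "metric_ray X r" using X.end_nonempty[OF \<omega>] .
    then have V: "r n \<in> verts X" for n by (auto simp: metric_ray_def ray_def)
    note lim = X.limitin_end[OF \<omega> r(1)]
    obtain \<eta> where \<eta>: "\<Phi> z = Inr \<eta>" "\<eta> \<in> proper_metric_ends Y"
      using ends \<omega> unfolding z X.ends_in_verts Y.ends_in_verts by blast
    have "limitin (end_topology Y) (Inl \<circ> (\<phi> \<circ> r)) (Inr \<eta>) sequentially"
      using continuous_map_limit[OF cont lim] ext V z \<eta> by (simp add: comp_def)
    moreover have "limitin (end_topology Y) (Inl \<circ> (\<phi> \<circ> r)) (Inr (end_map X Y \<phi> \<omega>)) sequentially"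
      using continuous_map_limit[OF continuous_map_end_extension lim] V \<omega>
      by (simp add: comp_def end_extension_Inl end_extension_Inr)
    ultimately have "\<eta> = end_map X Y \<phi> \<omega>"
      using Y.limitin_end_unique \<eta>(2) end_map_in_ends[OF \<omega>] by blast
    then show ?thesis using \<eta> z \<omega> by (simp add: end_extension_Inr)
  qed (use ext in \<open>simp add: end_extension_Inl\<close>)
qed

end

section \<open>From real constants to the extension theorem\<close>

text \<open>Distances are nonnegative, so the four real constants may all be enlarged to one natural
  number above them.\<close>

lemma quasi_isometry_pair:
  assumes "conn_graph X" "conn_graph Y" "quasi_isometry X Y \<phi>"
  obtains \<psi> K where "quasi_isometric_pair X Y \<phi> \<psi> K"
proof -
  obtain \<psi> and a b c d :: real where \<phi>: "\<phi> \<in> verts X \<rightarrow> verts Y" and \<psi>: "\<psi> \<in> verts Y \<rightarrow> verts X"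
    and a: "\<And>x\<^sub>1 x\<^sub>2. x\<^sub>1 \<in> verts X \<Longrightarrow> x\<^sub>2 \<in> verts X \<Longrightarrow>
        real (gdist Y (\<phi> x\<^sub>1) (\<phi> x\<^sub>2)) \<le> a * real (gdist X x\<^sub>1 x\<^sub>2)"
    and b: "\<And>y\<^sub>1 y\<^sub>2. y\<^sub>1 \<in> verts Y \<Longrightarrow> y\<^sub>2 \<in> verts Y \<Longrightarrow>
        real (gdist X (\<psi> y\<^sub>1) (\<psi> y\<^sub>2)) \<le> b * real (gdist Y y\<^sub>1 y\<^sub>2)"
    and c: "\<And>x. x \<in> verts X \<Longrightarrow> real (gdist X (\<psi> (\<phi> x)) x) \<le> c"
    and d: "\<And>y. y \<in> verts Y \<Longrightarrow> real (gdist Y (\<phi> (\<psi> y)) y) \<le> d"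
    using assms(3) unfolding quasi_isometry_def by blast
  obtain K :: nat where "max (max a b) (max c d) \<le> real K" using real_arch_simple by blast
  then have K: "a \<le> K" "b \<le> K" "c \<le> K" "d \<le> K" by auto
  have scale: "m \<le> K * n" if "real m \<le> t * real n" "t \<le> real K" for m n :: nat and t
  proof -
    have "real m \<le> real K * real n"
      using that by (meson mult_right_mono of_nat_0_le_iff order_trans)
    then show ?thesis by (metis of_nat_le_iff of_nat_mult)
  qed
  interpret X: conn_graph X by fact
  interpret Y: conn_graph Y by fact
  have "quasi_isometric_pair X Y \<phi> \<psi> K"
  proof unfold_locales
    show "gdist Y (\<phi> x\<^sub>1) (\<phi> x\<^sub>2) \<le> K * gdist X x\<^sub>1 x\<^sub>2" if "x\<^sub>1 \<in> verts X" "x\<^sub>2 \<in> verts X" for x\<^sub>1 x\<^sub>2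
      using scale[OF a[OF that] K(1)] .
    show "gdist X (\<psi> y\<^sub>1) (\<psi> y\<^sub>2) \<le> K * gdist Y y\<^sub>1 y\<^sub>2" if "y\<^sub>1 \<in> verts Y" "y\<^sub>2 \<in> verts Y" for y\<^sub>1 y\<^sub>2
      using scale[OF b[OF that] K(2)] .
    show "gdist X (\<psi> (\<phi> x)) x \<le> K" if "x \<in> verts X" for x using c[OF that] K(3) by linarith
    show "gdist Y (\<phi> (\<psi> y)) y \<le> K" if "y \<in> verts Y" for y using d[OF that] K(4) by linarith
  qed (use \<phi> \<psi> in auto)
  then show ?thesis by (rule that)
qed

theorem theorem6:
  fixes X :: "'a ugraph" and Y :: "'b ugraph" and \<phi> :: "'a \<Rightarrow> 'b"
  assumes "simple_graph X" and "connected_graph X"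
    and "simple_graph Y" and "connected_graph Y"
    and "quasi_isometry X Y \<phi>"
  shows "\<exists>!\<Phi>. \<Phi> \<in> (verts X <+> ends_in X (verts X)) \<rightarrow>\<^sub>E (verts Y <+> ends_in Y (verts Y)) \<and>
           (\<forall>x\<in>verts X. \<Phi> (Inl x) = Inl (\<phi> x)) \<and>
           continuous_map (end_topology X) (end_topology Y) \<Phi> \<and>
           homeomorphic_map
             (subtopology (end_topology X) (Inr ` ends_in X (verts X)))
             (subtopology (end_topology Y) (Inr ` ends_in Y (verts Y))) \<Phi>"
proof -
  obtain \<psi> K where "quasi_isometric_pair X Y \<phi> \<psi> K"
    using assms by (auto intro: quasi_isometry_pair conn_graph.intro)
  then interpret quasi_isometric_pair X Y \<phi> \<psi> K .
  have sub: "Inr ` ends_in G (verts G) \<subseteq> topspace (end_topology G)" for G :: "'c ugraph"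
    by (auto simp: topspace_end_topology)
  show ?thesis
  proof (rule ex1I[of _ "end_extension X Y \<phi>"], intro conjI ballI)
    fix \<Phi>
    assume \<Phi>: "\<Phi> \<in> (verts X <+> ends_in X (verts X)) \<rightarrow>\<^sub>E (verts Y <+> ends_in Y (verts Y)) \<and>
           (\<forall>x\<in>verts X. \<Phi> (Inl x) = Inl (\<phi> x)) \<and>
           continuous_map (end_topology X) (end_topology Y) \<Phi> \<and>
           homeomorphic_map
             (subtopology (end_topology X) (Inr ` ends_in X (verts X)))
             (subtopology (end_topology Y) (Inr ` ends_in Y (verts Y))) \<Phi>"
    \<comment> \<open>A homeomorphism onto the ends maps ends to ends, which supplies the last
      condition of \<open>end_extension_unique\<close>.\<close>
    then have "\<Phi> ` topspace (subtopology (end_topology X) (Inr ` ends_in X (verts X)))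
        = topspace (subtopology (end_topology Y) (Inr ` ends_in Y (verts Y)))"
      using homeomorphic_imp_surjective_map by blast
    then have "\<Phi> ` Inr ` ends_in X (verts X) = Inr ` ends_in Y (verts Y)"
      using sub[of X] sub[of Y] by (simp add: Int_absorb1)
    with \<Phi> show "\<Phi> = end_extension X Y \<phi>" by (intro end_extension_unique) auto
  qed (simp_all add: end_extension_PiE end_extension_Inl continuous_map_end_extension
      homeomorphic_map_end_extension)
qed

end
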